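(* Let $T_n$ be the chain triangular graph of order $n$. Then: (i) for every $n\geq 2$ and $k\geq 1$, if $n=2k$, then $$ABC_{GG}(T_n)=2\sum_{i=1}^{k}\left(\sqrt{\frac{2i-2}{2i-1}}+\sqrt{\frac{4k-2i}{4k-2i+1}}+\sqrt{\frac{4k-2}{(4k-2i+1)(2i-1)}}\right),$$ and if $n=2k+1$, then $$ABC_{GG}(T_n)=2\sum_{i=1}^{k}\left(\sqrt{\frac{2i-2}{2i-1}}+\sqrt{\frac{4k-2i+2}{4k-2i+3}}+\sqrt{\frac{4k}{(4k-2i+3)(2i-1)}}\right)+2\sqrt{\frac{2k}{2k+1}}+\frac{2\sqrt{k}}{2k+1};$$ (ii) for every $n\geq 2$, $$ABC(T_n)=\frac{2n+2}{\sqrt{2}}+\frac{(n-2)\sqrt{6}}{4}.$$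
   Context: For a finite simple graph $G$, $ABC(G)=\sum_{uv\in E(G)}\sqrt{\frac{d_u+d_v-2}{d_ud_v}}$, where $d_u$ is the degree of $u$ in $G$. For an edge $uv$ of $G$, $n_u(uv,G)$ is the number of vertices of $G$ strictly closer to $u$ than to $v$, and $n_v(uv,G)$ is defined analogously; equidistant vertices are not counted. $ABC_{GG}(G)=\sum_{uv\in E(G)}\sqrt{\frac{n_u(uv,G)+n_v(uv,G)-2}{n_u(uv,G)n_v(uv,G)}}$. The chain triangular graph $T_n$ of order $n$ (chain triangular cactus) consists of $n$ triangles glued in a chain: take $n$ disjoint triangles, the $i$-th with vertices $v_i,u_i,w_i$, and identify $w_i$ with $v_{i+1}$ for $i=1,\ldots,n-1$. *)

theory Defs
  imports Complex_Main "HOL-Library.Extended_Nat"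
begin

record 'a sgraph =
  verts :: "'a set"
  edges :: "'a set set"

definition simple_graph :: "'a sgraph \<Rightarrow> bool" where
  "simple_graph G \<longleftrightarrow> finite (verts G) \<and> (\<forall>e \<in> edges G. e \<subseteq> verts G \<and> card e = 2)"

definition degree :: "'a sgraph \<Rightarrow> 'a \<Rightarrow> nat" where
  "degree G u = card {e \<in> edges G. u \<in> e}"

definition adj :: "'a sgraph \<Rightarrow> 'a rel" where
  "adj G = {(u, v). {u, v} \<in> edges G}"

text \<open>The relation power \<open>adj G ^^ m\<close> relates the ends of walks with exactly \<open>m\<close> edges, so the
  distance is the least length of a walk, and \<open>\<infinity>\<close> if there is none.\<close>

definition gdist :: "'a sgraph \<Rightarrow> 'a \<Rightarrow> 'a \<Rightarrow> enat" where
  "gdist G u v = (INF m \<in> {m. (u, v) \<in> adj G ^^ m}. enat m)"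

text \<open>An edge is the set of its two ends. For \<open>e = {u, v}\<close> the set \<open>e - {u}\<close> is \<open>{v}\<close>, so
  \<open>closer_count G e u\<close> is $n_u(uv, G)$; likewise sums and products over \<open>e\<close> below have exactly
  the two terms for \<open>u\<close> and \<open>v\<close> (see the lemmas that follow).\<close>

definition closer_count :: "'a sgraph \<Rightarrow> 'a set \<Rightarrow> 'a \<Rightarrow> nat" where
  "closer_count G e u = card {x \<in> verts G. \<forall>v \<in> e - {u}. gdist G x u < gdist G x v}"

definition ABC :: "'a sgraph \<Rightarrow> real" where
  "ABC G = (\<Sum>e \<in> edges G.
     sqrt (((\<Sum>u \<in> e. real (degree G u)) - 2) / (\<Prod>u \<in> e. real (degree G u))))"

definition ABC_GG :: "'a sgraph \<Rightarrow> real" where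
  "ABC_GG G = (\<Sum>e \<in> edges G.
     sqrt (((\<Sum>u \<in> e. real (closer_count G e u)) - 2) / (\<Prod>u \<in> e. real (closer_count G e u))))"

lemma closer_count_doubleton:
  "u \<noteq> v \<Longrightarrow> closer_count G {u, v} u = card {x \<in> verts G. gdist G x u < gdist G x v}"
  "u \<noteq> v \<Longrightarrow> closer_count G {u, v} v = card {x \<in> verts G. gdist G x v < gdist G x u}"
  by (auto simp: closer_count_def insert_Diff_if)

lemma edge_term_doubleton:
  fixes f :: "'a \<Rightarrow> real"
  assumes "u \<noteq> v"
  shows "sqrt (((\<Sum>w \<in> {u, v}. f w) - 2) / (\<Prod>w \<in> {u, v}. f w))
       = sqrt ((f u + f v - 2) / (f u * f v))"
  using assms by simp

datatype tri_vertex = V nat | U nat | W nat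

text \<open>The chain triangular graph: \<open>n\<close> disjoint triangles with vertices \<open>V i\<close>, \<open>U i\<close>, \<open>W i\<close>
  for \<open>i = 1, \<dots>, n\<close>, and its image under the map that identifies \<open>W i\<close> with \<open>V (i + 1)\<close>
  for \<open>i < n\<close>. The vertex \<open>W n\<close> stays as it is.\<close>

definition triangles :: "nat \<Rightarrow> tri_vertex sgraph" where
  "triangles n = \<lparr>verts = (\<Union>i \<in> {1..n}. {V i, U i, W i}),
                  edges = (\<Union>i \<in> {1..n}. {{V i, U i}, {U i, W i}, {V i, W i}})\<rparr>"

fun glue :: "nat \<Rightarrow> tri_vertex \<Rightarrow> tri_vertex" where
  "glue n (W i) = (if i < n then V (i + 1) else W i)"
| "glue n x = x"

definition chain_triangular :: "nat \<Rightarrow> tri_vertex sgraph" where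
  "chain_triangular n = \<lparr>verts = glue n ` verts (triangles n),
                         edges = (\<lambda>e. glue n ` e) ` edges (triangles n)\<rparr>"

lemma simple_graph_chain_triangular: "simple_graph (chain_triangular n)"
proof -
  have "finite (verts (chain_triangular n))"
    by (simp add: chain_triangular_def triangles_def)
  moreover have "e \<subseteq> verts (chain_triangular n)" if "e \<in> edges (chain_triangular n)" for e
  proof -
    obtain t where t: "t \<in> edges (triangles n)" "e = glue n ` t"
      using \<open>e \<in> edges (chain_triangular n)\<close> by (auto simp: chain_triangular_def)
    then have "t \<subseteq> verts (triangles n)"
      by (auto simp: triangles_def)
    with t show ?thesis
      by (simp add: chain_triangular_def image_mono)
  qed
  moreover have "card e = 2" if "e \<in> edges (chain_triangular n)" for e
    using that by (auto simp: chain_triangular_def triangles_def card_insert_if)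
  ultimately show ?thesis
    by (simp add: simple_graph_def)
qed

end

theory Submission
  imports Defs
begin

text \<open>Once glued, \<open>T\<^sub>n\<close> is a path (the spine) with vertices \<open>1, \<dots>, n + 1\<close>, together with one apex \<open>U i\<close>
  over every spine edge from \<open>i\<close> to \<open>i + 1\<close>; both indices are therefore sums over \<open>i = 1, \<dots>, n\<close> of the
  contributions of the three edges of the \<open>i\<close>-th triangle.

  The cut vertices of that triangle leave \<open>2i - 1\<close> vertices on its left and \<open>2(n - i) + 1\<close> on its
  right (the two spine ends included), and \<open>U i\<close> is the only vertex outside both parts. A vertex of
  the left part reaches the apex and the right end at the same distance, one more than the left end,
  and symmetrically. Hence, with \<open>a = 2i - 1\<close> and \<open>b = 2(n - i) + 1\<close>, the closer counts on the three edges are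
  \<open>(a, 1)\<close>, \<open>(1, b)\<close> and \<open>(a, b)\<close>; this is \<open>closer_count_chain_triangular\<close>, which rests on the distance
  formula \<open>gdist_chain_triangular\<close>. The reflection \<open>i \<mapsto> n + 1 - i\<close> swaps \<open>a\<close> and \<open>b\<close>, so the sum over
  the triangles is twice the sum over the first half, plus the fixed middle triangle when \<open>n\<close> is
  odd; this gives the two closed forms of the Graovac-Ghorbani index.

  For the atom-bond connectivity index, an edge with an end of degree 2 contributes
  \<open>1/\<surd>2\<close> whatever the degree of the other end. This covers every edge except the \<open>n - 2\<close> spine
  edges of the inner triangles, whose ends both have degree 4 and which contribute \<open>\<surd>6/4\<close> each.\<close>

section \<open>Distances from a level function\<close>

text \<open>A function that grows by at most one along each edge is a lower bound for the length of walks
  from its zero, and following predecessors one level down gives a walk that attains the bound.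
  Distances can thus be certified from a closed formula by local checks.\<close>

lemma gdist_eq_level:
  fixes f :: "'a \<Rightarrow> nat"
  assumes root: "\<And>y. y \<in> A \<Longrightarrow> f y = 0 \<longleftrightarrow> y = u"
    and step: "\<And>x y. (x, y) \<in> adj G \<Longrightarrow> f y \<le> Suc (f x)"
    and pred: "\<And>y. y \<in> A \<Longrightarrow> y \<noteq> u \<Longrightarrow> \<exists>x \<in> A. (x, y) \<in> adj G \<and> f y = Suc (f x)"
    and "u \<in> A" "v \<in> A"
  shows "gdist G u v = enat (f v)"
proof -
  have lower: "f y \<le> m" if "(u, y) \<in> adj G ^^ m" for m y
    using that
  proof (induction m arbitrary: y)
    case 0
    then show ?case
      using root \<open>u \<in> A\<close> by auto
  next
    case (Suc m)
    then obtain x where "(u, x) \<in> adj G ^^ m" "(x, y) \<in> adj G"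
      by auto
    then show ?case
      using Suc.IH[of x] step[of x y] by linarith
  qed
  have walk: "(u, y) \<in> adj G ^^ f y" if "y \<in> A" for y
    using that
  proof (induction "f y" arbitrary: y)
    case 0
    then show ?case
      using root[of y] by simp
  next
    case (Suc m)
    then obtain x where "x \<in> A" "(x, y) \<in> adj G" "f y = Suc (f x)"
      using root[of y] pred[of y] by auto
    then show ?case
      using Suc.hyps by (auto intro!: relcompI[of u x])
  qed
  show ?thesis
    unfolding gdist_def
  proof (rule antisym)
    show "(INF m \<in> {m. (u, v) \<in> adj G ^^ m}. enat m) \<le> enat (f v)"
      using walk[OF \<open>v \<in> A\<close>] by (intro INF_lower) simp
    show "enat (f v) \<le> (INF m \<in> {m. (u, v) \<in> adj G ^^ m}. enat m)"
      using lower by (intro INF_greatest) simp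
  qed
qed

section \<open>The chain with the glued vertices named along its spine\<close>

text \<open>After gluing, the spine vertices are \<open>V 1, \<dots>, V n, W n\<close>; numbering them uniformly from \<open>1\<close> to
  \<open>n + 1\<close> removes the exceptional last triangle.\<close>

definition spine :: "nat \<Rightarrow> nat \<Rightarrow> tri_vertex" where
  "spine n p = (if p \<le> n then V p else W (p - 1))"

lemma spine_eq_iff [simp]: "spine n p = spine n q \<longleftrightarrow> p = q"
  by (auto simp: spine_def)

lemma spine_neq_U [simp]: "spine n p \<noteq> U i" "U i \<noteq> spine n p"
  by (auto simp: spine_def)

lemma glue_eq_spine:
  "glue n (W i) = spine n (i + 1)" "i \<le> n \<Longrightarrow> glue n (V i) = spine n i"
  by (simp_all add: spine_def)

lemma verts_chain_triangular:
  assumes "n \<ge> 1"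
  shows "verts (chain_triangular n) = spine n ` {1..n + 1} \<union> U ` {1..n}"
proof -
  have "verts (chain_triangular n) = (\<Union>i\<in>{1..n}. {spine n i, U i, spine n (i + 1)})"
    unfolding chain_triangular_def triangles_def sgraph.simps image_UN
    by (intro SUP_cong) (simp_all add: glue_eq_spine del: glue.simps(1,2))
  also have "\<dots> = spine n ` ({1..n} \<union> Suc ` {1..n}) \<union> U ` {1..n}"
    unfolding image_Un image_image Suc_eq_plus1 by blast
  also have "{1..n} \<union> Suc ` {1..n} = {1..n + 1}"
    using assms by (auto simp: image_Suc_atLeastAtMost)
  finally show ?thesis .
qed

lemma edges_chain_triangular:
  "edges (chain_triangular n) =
    (\<Union>i\<in>{1..n}. {{spine n i, U i}, {U i, spine n (i + 1)}, {spine n i, spine n (i + 1)}})"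
  unfolding chain_triangular_def triangles_def sgraph.simps image_UN
  by (intro SUP_cong) (simp_all add: glue_eq_spine del: glue.simps(1,2))

lemma triangle_edges:
  assumes "1 \<le> i" "i \<le> n"
  shows "{spine n i, U i} \<in> edges (chain_triangular n)"
    and "{U i, spine n (i + 1)} \<in> edges (chain_triangular n)"
    and "{spine n i, spine n (i + 1)} \<in> edges (chain_triangular n)"
  unfolding edges_chain_triangular using assms by (force intro: UN_I[of i])+

lemma edge_cases:
  assumes "e \<in> edges (chain_triangular n)"
  obtains i where "1 \<le> i" "i \<le> n"
    "e = {spine n i, U i} \<or> e = {U i, spine n (i + 1)} \<or> e = {spine n i, spine n (i + 1)}"
  using assms unfolding edges_chain_triangular by auto

lemma sum_edges_chain_triangular:
  fixes g :: "tri_vertex set \<Rightarrow> 'a::comm_monoid_add"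
  shows "(\<Sum>e\<in>edges (chain_triangular n). g e) =
    (\<Sum>i=1..n. g {spine n i, U i} + g {U i, spine n (i + 1)} + g {spine n i, spine n (i + 1)})"
proof -
  have "(\<Sum>e\<in>edges (chain_triangular n). g e) = (\<Sum>i=1..n. \<Sum>e\<in>{{spine n i, U i},
      {U i, spine n (i + 1)}, {spine n i, spine n (i + 1)}}. g e)"
    unfolding edges_chain_triangular
    by (rule sum.UNION_disjoint) (auto simp: doubleton_eq_iff)
  also have "\<dots> = (\<Sum>i=1..n. g {spine n i, U i} + g {U i, spine n (i + 1)}
      + g {spine n i, spine n (i + 1)})"
    by (intro sum.cong) (auto simp: doubleton_eq_iff add_ac)
  finally show ?thesis .
qed

section \<open>Distances and closer counts in the chain\<close>

text \<open>\<open>lo\<close> and \<open>hi\<close> place a vertex on the spine: a spine vertex occupies a single point, and an apex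
  spans the spine edge below it. Every \<open>W i\<close> gets the position \<open>i + 1\<close> of the vertex it is glued to, so
  that the spine positions do not depend on \<open>n\<close>.\<close>

fun lo :: "tri_vertex \<Rightarrow> nat" where
  "lo (V i) = i" | "lo (U i) = i" | "lo (W i) = i + 1"

fun hi :: "tri_vertex \<Rightarrow> nat" where
  "hi (V i) = i" | "hi (U i) = i + 1" | "hi (W i) = i + 1"

text \<open>The gap between the two spine intervals (in truncated subtraction at most one of the first two
  summands is nonzero), plus one step for leaving each apex involved. This fails only for
  an apex and itself, whence the case distinction.\<close>

definition hops :: "tri_vertex \<Rightarrow> tri_vertex \<Rightarrow> nat" where
  "hops x y = (if x = y then 0
     else (lo y - hi x) + (lo x - hi y) + (hi x - lo x) + (hi y - lo y))"

lemma lo_hi_spine [simp]: "lo (spine n p) = p" "hi (spine n p) = p"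
  by (auto simp: spine_def)

lemma hops_simps:
  "hops (spine n p) (spine n q) = (if p \<le> q then q - p else p - q)"
  "hops (spine n p) (U i) = (if p \<le> i then i + 1 - p else p - i)"
  "hops (U i) (spine n p) = (if p \<le> i then i + 1 - p else p - i)"
  "hops (U i) (U j) = (if i = j then 0 else if i < j then j + 1 - i else i + 1 - j)"
  by (auto simp: hops_def)

lemma hops_self [simp]: "hops x x = 0"
  by (simp add: hops_def)

text \<open>\<open>hops\<close> is a level function. For the predecessor of a vertex take the spine neighbour on the
  side of \<open>x\<close>; only for a spine vertex adjacent to an apex \<open>x\<close> is the predecessor \<open>x\<close> itself.\<close>

lemma gdist_chain_triangular:
  assumes "n \<ge> 1" and x: "x \<in> verts (chain_triangular n)" and y: "y \<in> verts (chain_triangular n)"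
  shows "gdist (chain_triangular n) x y = enat (hops x y)"
proof (rule gdist_eq_level[OF _ _ _ x y])
  note verts = verts_chain_triangular[OF \<open>n \<ge> 1\<close>]
  show "hops x z = 0 \<longleftrightarrow> z = x" if "z \<in> verts (chain_triangular n)" for z
    using that x by (auto simp: verts hops_simps split: if_splits)
  consider (x_spine) r where "x = spine n r" "1 \<le> r" "r \<le> n + 1"
    | (x_U) j where "x = U j" "1 \<le> j" "j \<le> n"
    using x by (auto simp: verts)
  note x_cases = this
  show "hops x z \<le> Suc (hops x y)" if "(y, z) \<in> adj (chain_triangular n)" for y z
  proof -
    have "{y, z} \<in> edges (chain_triangular n)"
      using that by (simp add: adj_def)
    then obtain i where "(y = spine n i \<or> y = U i \<or> y = spine n (i + 1)) \<and>
        (z = spine n i \<or> z = U i \<or> z = spine n (i + 1))"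
      by (rule edge_cases) (auto simp: doubleton_eq_iff)
    with x_cases show ?thesis
      by cases (auto simp: hops_simps)
  qed
  show "\<exists>y\<in>verts (chain_triangular n). (y, z) \<in> adj (chain_triangular n)
      \<and> hops x z = Suc (hops x y)"
    if z: "z \<in> verts (chain_triangular n)" "z \<noteq> x" for z
  proof (cases "{x, z} \<in> edges (chain_triangular n)")
    case True
    then have "hops x z = Suc (hops x x)"
      by (auto simp: hops_simps doubleton_eq_iff elim!: edge_cases)
    with True x show ?thesis
      by (auto simp: adj_def)
  next
    case False
    have "\<exists>q. 1 \<le> q \<and> q \<le> n + 1 \<and> {spine n q, z} \<in> edges (chain_triangular n)
        \<and> hops x z = Suc (hops x (spine n q))"
    proof -
      consider (z_spine) p where "z = spine n p" "1 \<le> p" "p \<le> n + 1"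
        | (z_U) i where "z = U i" "1 \<le> i" "i \<le> n"
        using z(1) by (auto simp: verts)
      then show ?thesis
      proof cases
        case z_spine
        \<comment> \<open>one step along the spine towards \<open>x\<close>\<close>
        define q where "q = (if hi x < p then p - 1 else p + 1)"
        from x_cases have q: "1 \<le> q \<and> q \<le> n + 1 \<and> hops x z = Suc (hops x (spine n q))"
        proof cases
          case x_spine
          then show ?thesis
            using z_spine z(2) by (auto simp: q_def hops_simps)
        next
          case x_U
          \<comment> \<open>the two spine vertices below an apex are its neighbours, a case already settled\<close>
          then have "p \<noteq> j" "p \<noteq> j + 1"
            using z_spine False triangle_edges(1,2)[of j n] by (auto simp: insert_commute)
          then show ?thesis
            using x_U z_spine by (auto simp: q_def hops_simps)
        qed
        have "p = q + 1 \<or> q = p + 1"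
          using z_spine by (simp add: q_def)
        then have "{spine n q, z} \<in> edges (chain_triangular n)"
          using z_spine q triangle_edges(3)[of p n] triangle_edges(3)[of q n]
          by (auto simp: insert_commute)
        with q show ?thesis by blast
      next
        case z_U
        \<comment> \<open>the end of the spine edge below the apex that faces \<open>x\<close>\<close>
        define q where "q = (if hi x \<le> i then i else i + 1)"
        from x_cases have "hops x z = Suc (hops x (spine n q))"
          by cases (use z_U z(2) in \<open>auto simp: q_def hops_simps\<close>)
        moreover have "{spine n q, z} \<in> edges (chain_triangular n)"
          using z_U triangle_edges(1,2)[of i n] by (simp add: q_def insert_commute)
        moreover have "1 \<le> q \<and> q \<le> n + 1"
          using z_U by (simp add: q_def)
        ultimately show ?thesis by blast
      qed
    qed
    then show ?thesis
      by (auto simp: adj_def verts)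
  qed
qed

lemma card_left_of:
  assumes "1 \<le> i" "i \<le> n"
  shows "card {x \<in> verts (chain_triangular n). hi x \<le> i} = 2 * i - 1"
proof -
  have "{x \<in> verts (chain_triangular n). hi x \<le> i} = spine n ` {1..i} \<union> U ` {1..<i}"
    using assms verts_chain_triangular[of n] by auto
  also have "card \<dots> = card {1..i} + card {1..<i}"
    by (subst card_Un_disjoint) (auto simp: card_image inj_on_def)
  finally show ?thesis
    using assms by simp
qed

lemma card_right_of:
  assumes "1 \<le> i" "i \<le> n"
  shows "card {x \<in> verts (chain_triangular n). i < lo x} = 2 * (n - i) + 1"
proof -
  have "{x \<in> verts (chain_triangular n). i < lo x} = spine n ` {i<..n + 1} \<union> U ` {i<..n}"
    using assms verts_chain_triangular[of n] by auto
  also have "card \<dots> = card {i<..n + 1} + card {i<..n}"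
    by (subst card_Un_disjoint) (auto simp: card_image inj_on_def)
  finally show ?thesis
    using assms by simp
qed

text \<open>The triangle over the spine edge from \<open>i\<close> to \<open>i + 1\<close> cuts the chain into the part \<open>hi x \<le> i\<close>, the
  part \<open>i < lo x\<close> and its apex. From within one part, the two triangle vertices outside the part are
  equidistant, so the vertices closer to a given end of an edge form exactly one of the three pieces.\<close>

lemma hops_less_iff:
  assumes "n \<ge> 1" and x: "x \<in> verts (chain_triangular n)"
  shows "hops x (spine n i) < hops x (U i) \<longleftrightarrow> hi x \<le> i"
    and "hops x (U i) < hops x (spine n i) \<longleftrightarrow> x = U i"
    and "hops x (U i) < hops x (spine n (i + 1)) \<longleftrightarrow> x = U i"
    and "hops x (spine n (i + 1)) < hops x (U i) \<longleftrightarrow> i < lo x"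
    and "hops x (spine n i) < hops x (spine n (i + 1)) \<longleftrightarrow> hi x \<le> i"
    and "hops x (spine n (i + 1)) < hops x (spine n i) \<longleftrightarrow> i < lo x"
  using x unfolding verts_chain_triangular[OF assms(1)]
  by (auto simp: hops_simps split: if_splits)

lemma closer_count_chain_triangular:
  assumes "1 \<le> i" "i \<le> n"
  defines "G \<equiv> chain_triangular n"
  shows "closer_count G {spine n i, U i} (spine n i) = 2 * i - 1"
    and "closer_count G {spine n i, U i} (U i) = 1"
    and "closer_count G {U i, spine n (i + 1)} (U i) = 1"
    and "closer_count G {U i, spine n (i + 1)} (spine n (i + 1)) = 2 * (n - i) + 1"
    and "closer_count G {spine n i, spine n (i + 1)} (spine n i) = 2 * i - 1"
    and "closer_count G {spine n i, spine n (i + 1)} (spine n (i + 1)) = 2 * (n - i) + 1"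
proof -
  have "n \<ge> 1" using assms by simp
  have mem: "spine n i \<in> verts G" "spine n (i + 1) \<in> verts G" "U i \<in> verts G"
    using assms by (auto simp: verts_chain_triangular)
  have closer: "card {x \<in> verts G. gdist G x u < gdist G x v} =
      card {x \<in> verts G. hops x u < hops x v}"
    if "u \<in> verts G" "v \<in> verts G" for u v
    using that gdist_chain_triangular[OF \<open>n \<ge> 1\<close>] unfolding G_def
    by (intro arg_cong[where f = card] Collect_cong) auto
  note less = hops_less_iff[OF \<open>n \<ge> 1\<close>, folded G_def]
  have single: "card {x \<in> verts G. x = U i} = 1"
  proof -
    have "{x \<in> verts G. x = U i} = {U i}"
      using mem(3) by blast
    then show ?thesis by simp
  qed
  have neq: "spine n i \<noteq> U i" "U i \<noteq> spine n (i + 1)" "spine n i \<noteq> spine n (i + 1)"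
    by simp_all
  note counts = closer_count_doubleton closer less single
    card_left_of[OF assms(1,2), folded G_def] card_right_of[OF assms(1,2), folded G_def]
  show "closer_count G {spine n i, U i} (spine n i) = 2 * i - 1"
    "closer_count G {spine n i, U i} (U i) = 1"
    "closer_count G {U i, spine n (i + 1)} (U i) = 1"
    "closer_count G {U i, spine n (i + 1)} (spine n (i + 1)) = 2 * (n - i) + 1"
    "closer_count G {spine n i, spine n (i + 1)} (spine n i) = 2 * i - 1"
    "closer_count G {spine n i, spine n (i + 1)} (spine n (i + 1)) = 2 * (n - i) + 1"
    by (simp_all only: counts mem neq simp_thms cong: conj_cong)
qed

section \<open>The Graovac-Ghorbani index\<close>

text \<open>The contribution of a triangle that has \<open>a\<close> vertices on its left and \<open>b\<close> on its right.\<close>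

definition tri_term :: "real \<Rightarrow> real \<Rightarrow> real" where
  "tri_term a b = sqrt ((a - 1) / a) + sqrt ((b - 1) / b) + sqrt ((a + b - 2) / (a * b))"

lemma tri_term_commute: "tri_term a b = tri_term b a"
  by (simp add: tri_term_def add.commute mult.commute)

lemma ABC_GG_chain_triangular:
  "ABC_GG (chain_triangular n) =
    (\<Sum>i=1..n. tri_term (2 * real i - 1) (2 * (real n - real i) + 1))"
  unfolding ABC_GG_def sum_edges_chain_triangular
proof (intro sum.cong refl)
  fix i assume "i \<in> {1..n}"
  then have i: "1 \<le> i" "i \<le> n" by auto
  have reals: "real (2 * i - 1) = 2 * real i - 1"
    "real (2 * (n - i) + 1) = 2 * (real n - real i) + 1"
    using i by (simp_all add: of_nat_diff)
  show "sqrt (((\<Sum>u\<in>{spine n i, U i}. real (closer_count (chain_triangular n) {spine n i, U i} u)) - 2) /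
          (\<Prod>u\<in>{spine n i, U i}. real (closer_count (chain_triangular n) {spine n i, U i} u))) +
      sqrt (((\<Sum>u\<in>{U i, spine n (i + 1)}. real (closer_count (chain_triangular n) {U i, spine n (i + 1)} u)) - 2) /
          (\<Prod>u\<in>{U i, spine n (i + 1)}. real (closer_count (chain_triangular n) {U i, spine n (i + 1)} u))) +
      sqrt (((\<Sum>u\<in>{spine n i, spine n (i + 1)}. real (closer_count (chain_triangular n) {spine n i, spine n (i + 1)} u)) - 2) /
          (\<Prod>u\<in>{spine n i, spine n (i + 1)}. real (closer_count (chain_triangular n) {spine n i, spine n (i + 1)} u)))
     = tri_term (2 * real i - 1) (2 * (real n - real i) + 1)"
    apply (subst edge_term_doubleton, simp)+
    unfolding closer_count_chain_triangular[OF i] reals tri_term_def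
    by simp
qed

lemma sum_symmetric_halves:
  fixes f :: "nat \<Rightarrow> 'a::comm_semiring_1"
  assumes sym: "\<And>i. 1 \<le> i \<Longrightarrow> i \<le> n \<Longrightarrow> f (n + 1 - i) = f i"
  shows "n = 2 * k \<Longrightarrow> (\<Sum>i=1..n. f i) = 2 * (\<Sum>i=1..k. f i)"
    and "n = 2 * k + 1 \<Longrightarrow> (\<Sum>i=1..n. f i) = 2 * (\<Sum>i=1..k. f i) + f (k + 1)"
proof -
  have upper: "(\<Sum>i=n+1-k..n. f i) = (\<Sum>i=1..k. f i)" if "k \<le> n"
    using that sym
    by (intro sum.reindex_bij_witness[of _ "\<lambda>i. n + 1 - i" "\<lambda>i. n + 1 - i"]) auto
  show "(\<Sum>i=1..n. f i) = 2 * (\<Sum>i=1..k. f i)" if "n = 2 * k"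
  proof -
    have "{1..n} = {1..k} \<union> {n+1-k..n}" "{1..k} \<inter> {n+1-k..n} = {}"
      using that by auto
    then have "(\<Sum>i=1..n. f i) = (\<Sum>i=1..k. f i) + (\<Sum>i=n+1-k..n. f i)"
      by (simp add: sum.union_disjoint)
    with upper that show ?thesis by (simp add: mult_2)
  qed
  show "(\<Sum>i=1..n. f i) = 2 * (\<Sum>i=1..k. f i) + f (k + 1)" if "n = 2 * k + 1"
  proof -
    have "{1..n} = insert (k + 1) ({1..k} \<union> {n+1-k..n})" "{1..k} \<inter> {n+1-k..n} = {}"
      "k + 1 \<notin> {1..k} \<union> {n+1-k..n}"
      using that by auto
    then have "(\<Sum>i=1..n. f i) = f (k + 1) + ((\<Sum>i=1..k. f i) + (\<Sum>i=n+1-k..n. f i))"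
      by (simp add: sum.union_disjoint)
    with upper that show ?thesis by (simp add: mult_2 add_ac)
  qed
qed

text \<open>Reflecting the chain exchanges the parts on the left and on the right of a triangle.\<close>

lemma tri_term_symmetric:
  assumes "1 \<le> i" "i \<le> n"
  shows "tri_term (2 * real (n + 1 - i) - 1) (2 * (real n - real (n + 1 - i)) + 1) =
    tri_term (2 * real i - 1) (2 * (real n - real i) + 1)"
proof -
  have "2 * real (n + 1 - i) - 1 = 2 * (real n - real i) + 1"
    "2 * (real n - real (n + 1 - i)) + 1 = 2 * real i - 1"
    using assms by (simp_all add: of_nat_diff)
  then show ?thesis
    by (simp only: tri_term_commute)
qed

section \<open>The atom-bond connectivity index\<close>

lemma degree_U:
  assumes "1 \<le> i" "i \<le> n"
  shows "degree (chain_triangular n) (U i) = 2"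
proof -
  have "{e \<in> edges (chain_triangular n). U i \<in> e} = {{spine n i, U i}, {U i, spine n (i + 1)}}"
    (is "?E = ?T")
  proof
    show "?E \<subseteq> ?T"
      by (auto elim!: edge_cases)
    show "?T \<subseteq> ?E"
      using triangle_edges[OF assms] by auto
  qed
  then show ?thesis
    by (simp add: degree_def doubleton_eq_iff)
qed

text \<open>An inner spine vertex lies in two consecutive triangles and has two edges in each; the two
  ends of the spine lie in one triangle only.\<close>

lemma degree_spine:
  assumes "n \<ge> 1" "1 \<le> p" "p \<le> n + 1"
  shows "degree (chain_triangular n) (spine n p) = (if p = 1 \<or> p = n + 1 then 2 else 4)"
proof -
  \<comment> \<open>the edges at \<open>spine n p\<close> in the triangles \<open>p - 1\<close> and \<open>p\<close>, where those exist\<close>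
  define L where "L = {{U (p - 1), spine n p}, {spine n (p - 1), spine n p}}"
  define R where "R = {{spine n p, U p}, {spine n p, spine n (p + 1)}}"
  have card: "card R = 2" "p > 1 \<Longrightarrow> card L = 2" "p > 1 \<Longrightarrow> L \<inter> R = {}" "finite L" "finite R"
    by (auto simp: L_def R_def doubleton_eq_iff)
  have "{e \<in> edges (chain_triangular n). spine n p \<in> e} =
      (if p = 1 then {} else L) \<union> (if p = n + 1 then {} else R)"
  proof (intro set_eqI iffI)
    fix e assume "e \<in> {e \<in> edges (chain_triangular n). spine n p \<in> e}"
    then have "e \<in> edges (chain_triangular n)" and p: "spine n p \<in> e"
      by auto
    from this(1) obtain i where i: "1 \<le> i" "i \<le> n" and
      e: "e = {spine n i, U i} \<or> e = {U i, spine n (i + 1)} \<or> e = {spine n i, spine n (i + 1)}"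
      by (rule edge_cases)
    then have "p = i \<or> p = i + 1"
      using p by auto
    then show "e \<in> (if p = 1 then {} else L) \<union> (if p = n + 1 then {} else R)"
    proof
      assume "p = i"
      then show ?thesis
        using i(2) e p by (auto simp: R_def doubleton_eq_iff)
    next
      assume "p = i + 1"
      then show ?thesis
        using i(1) e p by (auto simp: L_def doubleton_eq_iff)
    qed
  next
    fix e assume e: "e \<in> (if p = 1 then {} else L) \<union> (if p = n + 1 then {} else R)"
    then consider "p > 1" "e \<in> L" | "p \<le> n" "e \<in> R"
      using assms by (auto split: if_splits)
    then show "e \<in> {e \<in> edges (chain_triangular n). spine n p \<in> e}"
    proof cases
      case 1
      then show ?thesis
        using assms triangle_edges[of "p - 1" n] by (auto simp: L_def)
    next
      case 2
      then show ?thesis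
        using assms triangle_edges[of p n] by (auto simp: R_def)
    qed
  qed
  then have "degree (chain_triangular n) (spine n p) =
      card ((if p = 1 then {} else L) \<union> (if p = n + 1 then {} else R))"
    by (simp add: degree_def)
  moreover have "p > 1" if "p \<noteq> 1"
    using that assms(2) by simp
  ultimately show ?thesis
    using card assms(1) by (auto simp: card_Un_disjoint)
qed

lemma ABC_chain_triangular:
  assumes "n \<ge> 2"
  shows "ABC (chain_triangular n) = (2 * real n + 2) / sqrt 2 + (real n - 2) * sqrt 6 / 4"
proof -
  define d where "d = (\<lambda>x. real (degree (chain_triangular n) x))"
  define g where "g = (\<lambda>e. sqrt (((\<Sum>u\<in>e. d u) - 2) / (\<Prod>u\<in>e. d u)))"
  \<comment> \<open>the contribution of the \<open>i\<close>-th spine edge; only the first and the last spine edge have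
    an end of degree 2, and they are distinct because \<open>n \<ge> 2\<close>\<close>
  define h where "h = (\<lambda>i. if i = 1 \<or> i = n then 1 / sqrt 2 else sqrt 6 / 4)"
  have g2: "g {x, y} = 1 / sqrt 2" if "x \<noteq> y" "d x = 2 \<or> d y = 2" "d x > 0" "d y > 0" for x y
  proof -
    have "g {x, y} = sqrt ((d x + d y - 2) / (d x * d y))"
      using that(1) by (simp add: g_def)
    also have "(d x + d y - 2) / (d x * d y) = 1 / 2"
      using that by (auto simp: field_simps)
    finally show ?thesis
      by (simp add: real_sqrt_divide)
  qed
  have g4: "g {x, y} = sqrt 6 / 4" if "x \<noteq> y" "d x = 4" "d y = 4" for x y
    using that by (simp add: g_def real_sqrt_divide)
  have "ABC (chain_triangular n) = (\<Sum>e\<in>edges (chain_triangular n). g e)"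
    by (simp add: ABC_def g_def d_def)
  also have "\<dots> = (\<Sum>i=1..n. 2 / sqrt 2 + h i)"
    unfolding sum_edges_chain_triangular
  proof (intro sum.cong refl)
    fix i assume "i \<in> {1..n}"
    then have d: "d (U i) = 2" "d (spine n i) = (if i = 1 then 2 else 4)"
      "d (spine n (i + 1)) = (if i = n then 2 else 4)"
      using assms by (auto simp: d_def degree_U degree_spine)
    have "g {spine n i, U i} = 1 / sqrt 2" "g {U i, spine n (i + 1)} = 1 / sqrt 2"
      using g2[of "spine n i" "U i"] g2[of "U i" "spine n (i + 1)"] unfolding d by auto
    moreover have "g {spine n i, spine n (i + 1)} = h i"
      using g2[of "spine n i" "spine n (i + 1)"] g4[of "spine n i" "spine n (i + 1)"]
      unfolding h_def d by auto
    ultimately show "g {spine n i, U i} + g {U i, spine n (i + 1)}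
        + g {spine n i, spine n (i + 1)} = 2 / sqrt 2 + h i"
      by simp
  qed
  also have "\<dots> = real n * (2 / sqrt 2) + (\<Sum>i=1..n. h i)"
    by (simp add: sum.distrib)
  also have "(\<Sum>i=1..n. h i) = 2 / sqrt 2 + (real n - 2) * (sqrt 6 / 4)"
  proof -
    have "{1..n} = insert 1 (insert n {1<..<n})"
      using assms by auto
    then have "(\<Sum>i=1..n. h i) = h 1 + h n + (\<Sum>i\<in>{1<..<n}. h i)"
      using assms by simp
    also have "(\<Sum>i\<in>{1<..<n}. h i) = (\<Sum>i\<in>{1<..<n}. sqrt 6 / 4)"
      by (intro sum.cong) (auto simp: h_def)
    also have "\<dots> = (real n - 2) * (sqrt 6 / 4)"
      using assms by (simp add: of_nat_diff)
    finally show ?thesis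
      by (simp add: h_def)
  qed
  finally show ?thesis
    by (simp add: add_divide_distrib)
qed

section \<open>Both indices in closed form\<close>

theorem theorem3p3:
  "(\<forall>n k :: nat. n \<ge> 2 \<and> k \<ge> 1 \<longrightarrow>
      (n = 2 * k \<longrightarrow>
        ABC_GG (chain_triangular n) =
          2 * (\<Sum>i = 1..k.
                 sqrt ((2 * real i - 2) / (2 * real i - 1))
               + sqrt ((4 * real k - 2 * real i) / (4 * real k - 2 * real i + 1))
               + sqrt ((4 * real k - 2) / ((4 * real k - 2 * real i + 1) * (2 * real i - 1))))) \<and>
      (n = 2 * k + 1 \<longrightarrow>
        ABC_GG (chain_triangular n) =
          2 * (\<Sum>i = 1..k.
                 sqrt ((2 * real i - 2) / (2 * real i - 1))
               + sqrt ((4 * real k - 2 * real i + 2) / (4 * real k - 2 * real i + 3))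
               + sqrt (4 * real k / ((4 * real k - 2 * real i + 3) * (2 * real i - 1))))
          + 2 * sqrt (2 * real k / (2 * real k + 1))
          + 2 * sqrt (real k) / (2 * real k + 1)))
   \<and> (\<forall>n :: nat. n \<ge> 2 \<longrightarrow>
        ABC (chain_triangular n) = (2 * real n + 2) / sqrt 2 + (real n - 2) * sqrt 6 / 4)"
proof (intro conjI allI impI)
  fix n k :: nat
  assume "n \<ge> 2 \<and> k \<ge> 1"
  define f where "f = (\<lambda>i. tri_term (2 * real i - 1) (2 * (real n - real i) + 1))"
  have index: "ABC_GG (chain_triangular n) = (\<Sum>i=1..n. f i)"
    by (simp add: f_def ABC_GG_chain_triangular)
  have sym: "f (n + 1 - i) = f i" if "1 \<le> i" "i \<le> n" for i
    unfolding f_def by (rule tri_term_symmetric[OF that])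
  {
    assume n: "n = 2 * k"
    have half: "(\<Sum>i=1..n. f i) = 2 * (\<Sum>i=1..k. f i)"
      using sum_symmetric_halves(1)[of n f k] sym n by blast
    have f: "f i = sqrt ((2 * real i - 2) / (2 * real i - 1))
               + sqrt ((4 * real k - 2 * real i) / (4 * real k - 2 * real i + 1))
               + sqrt ((4 * real k - 2) / ((4 * real k - 2 * real i + 1) * (2 * real i - 1)))"
      for i
      by (simp add: f_def n tri_term_def algebra_simps)
    show "ABC_GG (chain_triangular n) =
          2 * (\<Sum>i = 1..k.
                 sqrt ((2 * real i - 2) / (2 * real i - 1))
               + sqrt ((4 * real k - 2 * real i) / (4 * real k - 2 * real i + 1))
               + sqrt ((4 * real k - 2) / ((4 * real k - 2 * real i + 1) * (2 * real i - 1))))"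
      unfolding index half f ..
  next
    assume n: "n = 2 * k + 1"
    have half: "(\<Sum>i=1..n. f i) = 2 * (\<Sum>i=1..k. f i) + f (k + 1)"
      using sum_symmetric_halves(2)[of n f k] sym n by blast
    have f: "f i = sqrt ((2 * real i - 2) / (2 * real i - 1))
               + sqrt ((4 * real k - 2 * real i + 2) / (4 * real k - 2 * real i + 3))
               + sqrt (4 * real k / ((4 * real k - 2 * real i + 3) * (2 * real i - 1)))" for i
      by (simp add: f_def n tri_term_def algebra_simps)
    have "f (k + 1) = tri_term (2 * real k + 1) (2 * real k + 1)"
      by (simp add: f_def n add.commute)
    also have "\<dots> = 2 * sqrt (2 * real k / (2 * real k + 1))
        + sqrt ((4 * real k) / (2 * real k + 1)\<^sup>2)"
      by (simp add: tri_term_def power2_eq_square)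
    also have "sqrt ((4 * real k) / (2 * real k + 1)\<^sup>2) = 2 * sqrt (real k) / (2 * real k + 1)"
      by (simp add: real_sqrt_divide real_sqrt_mult)
    finally have middle: "f (k + 1) = 2 * sqrt (2 * real k / (2 * real k + 1))
        + 2 * sqrt (real k) / (2 * real k + 1)" .
    show "ABC_GG (chain_triangular n) =
          2 * (\<Sum>i = 1..k.
                 sqrt ((2 * real i - 2) / (2 * real i - 1))
               + sqrt ((4 * real k - 2 * real i + 2) / (4 * real k - 2 * real i + 3))
               + sqrt (4 * real k / ((4 * real k - 2 * real i + 3) * (2 * real i - 1))))
          + 2 * sqrt (2 * real k / (2 * real k + 1))
          + 2 * sqrt (real k) / (2 * real k + 1)"
      unfolding index half middle unfolding f by simp
  }
next
  fix n :: nat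
  assume "n \<ge> 2"
  then show "ABC (chain_triangular n) = (2 * real n + 2) / sqrt 2 + (real n - 2) * sqrt 6 / 4"
    by (rule ABC_chain_triangular)
qed

end
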